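(* Let $R$ be a ring without non-trivial central idempotents such that $J(R)\neq 0$ but $J(eRe)=0$ for every proper idempotent $e$ of $R$. Then the following are equivalent: (1) $R$ is a VNL ring. (2) $R$ is an exchange ring. (3) $R$ is a potent ring. (4) $R$ is a semipotent ring. (5) $R$ is an NJ ring.
   Context: Rings are associative with identity; $J(R)$ is the Jacobson radical of $R$. A proper (non-trivial) idempotent is an idempotent different from $0$ and $1$. An element $a$ of a ring $R$ is (von Neumann) regular if $a=aba$ for some $b\in R$. A ring $R$ is VNL if for each $a\in R$, either $a$ or $1-a$ is regular. $R$ is an exchange ring if for every $a\in R$ there exists an idempotent $e\in aR$ such that $1-e\in(1-a)R$. $R$ is semipotent if every right ideal not contained in $J(R)$ contains a nonzero idempotent. $R$ is potent if it is semipotent and idempotents lift modulo $J(R)$. $R$ is NJ if every element of $R\setminus J(R)$ is regular. *)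

theory Defs
  imports "HOL-Algebra.Ideal"
begin

section \<open>One-sided ideals and the Jacobson radical\<close>

locale right_ideal = additive_subgroup I R + ring R for I and R (structure) +
  assumes I_r_closed: "\<lbrakk>a \<in> I; x \<in> carrier R\<rbrakk> \<Longrightarrow> a \<otimes> x \<in> I"

locale maximal_right_ideal = right_ideal +
  assumes I_notcarr: "carrier R \<noteq> I"
    and I_maximal: "\<lbrakk>right_ideal J R; I \<subseteq> J\<rbrakk> \<Longrightarrow> J = I \<or> J = carrier R"

text \<open>The intersection with the carrier only matters for the zero ring, which has no maximal
  right ideals and is its own radical.\<close>

definition jacobson_radical :: "('a, 'b) ring_scheme \<Rightarrow> 'a set"
  where "jacobson_radical R = carrier R \<inter> \<Inter>{M. maximal_right_ideal M R}"

section \<open>Idempotents and corner rings\<close>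

definition ring_idempotent :: "('a, 'b) ring_scheme \<Rightarrow> 'a \<Rightarrow> bool"
  where "ring_idempotent R e \<longleftrightarrow> e \<in> carrier R \<and> e \<otimes>\<^bsub>R\<^esub> e = e"

definition proper_idempotent :: "('a, 'b) ring_scheme \<Rightarrow> 'a \<Rightarrow> bool"
  where "proper_idempotent R e \<longleftrightarrow> ring_idempotent R e \<and> e \<noteq> \<zero>\<^bsub>R\<^esub> \<and> e \<noteq> \<one>\<^bsub>R\<^esub>"

definition central_element :: "('a, 'b) ring_scheme \<Rightarrow> 'a \<Rightarrow> bool"
  where "central_element R c \<longleftrightarrow>
    c \<in> carrier R \<and> (\<forall>x\<in>carrier R. c \<otimes>\<^bsub>R\<^esub> x = x \<otimes>\<^bsub>R\<^esub> c)"

text \<open>The ring $eRe$: the operations and zero are those of $R$, but its identity is $e$.\<close>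

definition corner_ring :: "('a, 'b) ring_scheme \<Rightarrow> 'a \<Rightarrow> ('a, 'b) ring_scheme"
  where "corner_ring R e =
    R\<lparr>carrier := {e \<otimes>\<^bsub>R\<^esub> x \<otimes>\<^bsub>R\<^esub> e | x. x \<in> carrier R}, one := e\<rparr>"

lemma ring_corner_ring:
  fixes R (structure)
  assumes "ring R" and "ring_idempotent R e"
  shows "ring (corner_ring R e)"
proof -
  interpret ring R by fact
  have e: "e \<in> carrier R" and ee: "e \<otimes> e = e"
    using assms(2) by (auto simp: ring_idempotent_def)
  have cl: "x \<in> carrier R" if "x \<in> carrier (corner_ring R e)" for x
    using that e by (auto simp: corner_ring_def)
  have fixed: "e \<otimes> x = x" "x \<otimes> e = x" if "x \<in> carrier (corner_ring R e)" for x
    using that e ee by (auto simp: corner_ring_def m_assoc) (metis ee m_assoc m_closed)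
  have mem: "x \<in> carrier (corner_ring R e)" if "x \<in> carrier R" "e \<otimes> x = x" "x \<otimes> e = x" for x
    using that by (force simp: corner_ring_def)
  have ops: "mult (corner_ring R e) = mult R" "add (corner_ring R e) = add R"
    "zero (corner_ring R e) = zero R" "one (corner_ring R e) = e"
    by (simp_all add: corner_ring_def)
  show ?thesis
  proof (rule ringI)
    show "abelian_group (corner_ring R e)"
    proof (rule abelian_groupI)
      fix x assume x: "x \<in> carrier (corner_ring R e)"
      have "\<ominus> x \<in> carrier (corner_ring R e)"
        using x cl e fixed by (intro mem) (auto simp: r_minus l_minus)
      then show "\<exists>y\<in>carrier (corner_ring R e).
          y \<oplus>\<^bsub>corner_ring R e\<^esub> x = \<zero>\<^bsub>corner_ring R e\<^esub>"
        using x cl[OF x] by (intro bexI[of _ "\<ominus> x"]) (auto simp: ops l_neg)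
    qed (auto simp: ops cl e fixed a_ac l_distr r_distr intro!: mem)
    show "monoid (corner_ring R e)"
      by (rule monoidI) (auto simp: ops cl e ee fixed m_assoc intro!: mem, metis cl e fixed(1) m_assoc)
  qed (auto simp: ops cl l_distr r_distr)
qed

section \<open>Classes of rings\<close>

definition regular_element :: "('a, 'b) ring_scheme \<Rightarrow> 'a \<Rightarrow> bool"
  where "regular_element R a \<longleftrightarrow>
    a \<in> carrier R \<and> (\<exists>b\<in>carrier R. a = a \<otimes>\<^bsub>R\<^esub> b \<otimes>\<^bsub>R\<^esub> a)"

definition VNL_ring :: "('a, 'b) ring_scheme \<Rightarrow> bool"
  where "VNL_ring R \<longleftrightarrow>
    (\<forall>a\<in>carrier R. regular_element R a \<or> regular_element R (\<one>\<^bsub>R\<^esub> \<ominus>\<^bsub>R\<^esub> a))"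

text \<open>\<open>a <#\<^bsub>R\<^esub> carrier R\<close> is the principal right ideal $aR$.\<close>

definition exchange_ring :: "('a, 'b) ring_scheme \<Rightarrow> bool"
  where "exchange_ring R \<longleftrightarrow>
    (\<forall>a\<in>carrier R. \<exists>e. ring_idempotent R e \<and> e \<in> a <#\<^bsub>R\<^esub> carrier R \<and>
       \<one>\<^bsub>R\<^esub> \<ominus>\<^bsub>R\<^esub> e \<in> (\<one>\<^bsub>R\<^esub> \<ominus>\<^bsub>R\<^esub> a) <#\<^bsub>R\<^esub> carrier R)"

definition semipotent_ring :: "('a, 'b) ring_scheme \<Rightarrow> bool"
  where "semipotent_ring R \<longleftrightarrow>
    (\<forall>I. right_ideal I R \<and> \<not> I \<subseteq> jacobson_radical R \<longrightarrow>
       (\<exists>e\<in>I. ring_idempotent R e \<and> e \<noteq> \<zero>\<^bsub>R\<^esub>))"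

definition idempotents_lift_modulo :: "('a, 'b) ring_scheme \<Rightarrow> 'a set \<Rightarrow> bool"
  where "idempotents_lift_modulo R I \<longleftrightarrow>
    (\<forall>a\<in>carrier R. a \<otimes>\<^bsub>R\<^esub> a \<ominus>\<^bsub>R\<^esub> a \<in> I \<longrightarrow>
       (\<exists>e. ring_idempotent R e \<and> e \<ominus>\<^bsub>R\<^esub> a \<in> I))"

definition potent_ring :: "('a, 'b) ring_scheme \<Rightarrow> bool"
  where "potent_ring R \<longleftrightarrow>
    semipotent_ring R \<and> idempotents_lift_modulo R (jacobson_radical R)"

definition NJ_ring :: "('a, 'b) ring_scheme \<Rightarrow> bool"
  where "NJ_ring R \<longleftrightarrow> (\<forall>a\<in>carrier R - jacobson_radical R. regular_element R a)"

end

(* The cycle NJ \<Longrightarrow> VNL \<Longrightarrow> exchange \<Longrightarrow> potent \<Longrightarrow> semipotent \<Longrightarrow> NJ has only its last step depending on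
   the special hypotheses. Let e be a proper idempotent and f = 1 - e. Since eJe = fJf = 0 but
   J \<noteq> 0, the corner eRe has no proper idempotents, so semipotency makes it a division ring; the
   same holds for fRf. As e and f are not equivalent, eRfRe = fReRf = 0. If a \<notin> J, then aR
   contains a nonzero idempotent e, which forces e = 1 or eae \<noteq> 0. In the latter case the inverse
   of eae is a quasi-inverse of a if faf = 0, and a is right invertible otherwise. *)

theory Submission
  imports Defs
begin

section \<open>Right ideals and the Jacobson radical\<close>

context ring
begin

section \<open>Right ideals: closure criteria, principal ideals and sums\<close>

lemma right_idealI:
  assumes "I \<subseteq> carrier R" "\<zero> \<in> I"
    and "\<And>x y. x \<in> I \<Longrightarrow> y \<in> I \<Longrightarrow> x \<oplus> y \<in> I"
    and mult: "\<And>x r. x \<in> I \<Longrightarrow> r \<in> carrier R \<Longrightarrow> x \<otimes> r \<in> I"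
  shows "right_ideal I R"
proof -
  \<comment> \<open>Negatives come from right multiplication by -1, so closure under addition and
    right multiplication already yields an additive subgroup.\<close>
  have "\<ominus> x \<in> I" if "x \<in> I" for x
    using mult[OF that, of "\<ominus> \<one>"] that assms(1) by (auto simp: r_minus subset_iff)
  then have "subgroup I (add_monoid R)"
    using assms by (intro add.subgroupI) (auto simp flip: a_inv_def)
  then show ?thesis
    using mult by unfold_locales (auto intro: additive_subgroup.intro simp: subgroup_def)
qed

lemma right_ideal_mem:
  assumes "right_ideal I R"
  shows right_ideal_carrier: "x \<in> I \<Longrightarrow> x \<in> carrier R"
    and right_ideal_zero: "\<zero> \<in> I"
    and right_ideal_add: "x \<in> I \<Longrightarrow> y \<in> I \<Longrightarrow> x \<oplus> y \<in> I"
    and right_ideal_mult: "x \<in> I \<Longrightarrow> r \<in> carrier R \<Longrightarrow> x \<otimes> r \<in> I"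
proof -
  interpret right_ideal I R by fact
  show "x \<in> I \<Longrightarrow> x \<in> carrier R" "\<zero> \<in> I" "x \<in> I \<Longrightarrow> y \<in> I \<Longrightarrow> x \<oplus> y \<in> I"
    "x \<in> I \<Longrightarrow> r \<in> carrier R \<Longrightarrow> x \<otimes> r \<in> I"
    by (auto intro: I_r_closed)
qed

lemma right_ideal_eq_carrier:
  assumes "right_ideal I R" "\<one> \<in> I"
  shows "I = carrier R"
  using right_ideal_mult[OF assms] right_ideal_carrier[OF assms(1)] by fastforce

lemma mem_l_coset_carrier: "y \<in> x <# carrier R \<longleftrightarrow> (\<exists>r\<in>carrier R. y = x \<otimes> r)"
  by (auto simp: l_coset_def)

lemma right_ideal_principal:
  assumes "x \<in> carrier R"
  shows "right_ideal (x <# carrier R) R"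
  using assms
  by (intro right_idealI)
     (auto simp: mem_l_coset_carrier m_assoc intro: bexI[of _ \<zero>] simp flip: r_distr)

text \<open>The right ideal M + xR. For x outside a maximal M it must be the whole ring, which
  yields an equation 1 = m + xr.\<close>

lemma right_ideal_add_principal:
  assumes "right_ideal M R" "x \<in> carrier R"
  shows "right_ideal {m \<oplus> x \<otimes> r | m r. m \<in> M \<and> r \<in> carrier R} R" (is "right_ideal ?S R")
proof (rule right_idealI)
  note M = right_ideal_mem[OF assms(1)]
  show "?S \<subseteq> carrier R"
    using M(1) assms(2) by auto
  show "\<zero> \<in> ?S"
    using M(2) assms(2) by (force intro: exI[of _ \<zero>])
  show "y \<oplus> z \<in> ?S" if yz: "y \<in> ?S" "z \<in> ?S" for y z
  proof -
    obtain m r m' r' where *: "y = m \<oplus> x \<otimes> r" "z = m' \<oplus> x \<otimes> r'" "m \<in> M" "m' \<in> M"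
      "r \<in> carrier R" "r' \<in> carrier R"
      using yz by blast
    then have "y \<oplus> z = (m \<oplus> m') \<oplus> x \<otimes> (r \<oplus> r')"
      using M(1) assms(2) by (simp add: r_distr a_ac)
    then show ?thesis
      using * M(3) by blast
  qed
  show "y \<otimes> s \<in> ?S" if ys: "y \<in> ?S" "s \<in> carrier R" for y s
  proof -
    obtain m r where *: "y = m \<oplus> x \<otimes> r" "m \<in> M" "r \<in> carrier R"
      using ys by blast
    then have "y \<otimes> s = m \<otimes> s \<oplus> x \<otimes> (r \<otimes> s)"
      using M(1) assms(2) ys(2) by (simp add: l_distr m_assoc)
    then show ?thesis
      using * M(4) ys(2) by blast
  qed
qed

section \<open>Maximal right ideals and the radical in terms of right inverses\<close>

text \<open>Zorn's lemma applies because properness is expressed as 1 not being a member, a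
  condition that survives unions of chains.\<close>

lemma maximal_right_ideal_exists:
  assumes I: "right_ideal I R" "\<one> \<notin> I"
  shows "\<exists>M. maximal_right_ideal M R \<and> I \<subseteq> M"
proof -
  define A where "A = {K. right_ideal K R \<and> \<one> \<notin> K \<and> I \<subseteq> K}"
  have "\<exists>M\<in>A. \<forall>X\<in>A. M \<subseteq> X \<longrightarrow> X = M"
  proof (rule subset_Zorn_nonempty)
    show "A \<noteq> {}"
      using I by (auto simp: A_def)
    fix C assume C: "C \<noteq> {}" "subset.chain A C"
    then have CA: "\<And>K. K \<in> C \<Longrightarrow> right_ideal K R \<and> \<one> \<notin> K \<and> I \<subseteq> K"
      and ch: "\<And>K L. K \<in> C \<Longrightarrow> L \<in> C \<Longrightarrow> K \<subseteq> L \<or> L \<subseteq> K"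
      by (auto simp: subset_chain_def A_def)
    have "right_ideal (\<Union>C) R"
    proof (rule right_idealI)
      show "\<Union>C \<subseteq> carrier R"
        using CA right_ideal_carrier by blast
      show "\<zero> \<in> \<Union>C"
        using C(1) CA right_ideal_zero by blast
      show "x \<otimes> r \<in> \<Union>C" if "x \<in> \<Union>C" "r \<in> carrier R" for x r
        using that CA right_ideal_mult by blast
      show "x \<oplus> y \<in> \<Union>C" if xy: "x \<in> \<Union>C" "y \<in> \<Union>C" for x y
      proof -
        obtain K L where "x \<in> K" "K \<in> C" "y \<in> L" "L \<in> C"
          using xy by blast
        then obtain H where "H \<in> C" "x \<in> H" "y \<in> H"
          using ch by blast
        then show ?thesis
          using CA right_ideal_add by blast
      qed
    qed
    then show "\<Union>C \<in> A"
      using C(1) CA by (auto simp: A_def)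
  qed
  then obtain M where M: "right_ideal M R" "\<one> \<notin> M" "I \<subseteq> M"
    and max: "\<And>X. right_ideal X R \<Longrightarrow> \<one> \<notin> X \<Longrightarrow> M \<subseteq> X \<Longrightarrow> X = M"
    unfolding A_def by (smt (verit) mem_Collect_eq order_trans)
  have "maximal_right_ideal M R"
    using M max right_ideal_eq_carrier
    by (auto simp: maximal_right_ideal_def maximal_right_ideal_axioms_def)
  then show ?thesis
    using M(3) by blast
qed

text \<open>If 1 - xr has no right inverse, then (1 - xr)R lies in a maximal right ideal, which also
  contains xr and hence 1. Conversely, if x is outside a maximal M, then M + xR is everything, so
  some 1 - xr lies in M, and a right inverse of it would put 1 into M.\<close>

lemma mem_jacobson_radical_iff:
  "x \<in> jacobson_radical R \<longleftrightarrow>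
    x \<in> carrier R \<and> (\<forall>r\<in>carrier R. \<exists>u\<in>carrier R. (\<one> \<ominus> x \<otimes> r) \<otimes> u = \<one>)"
proof (intro iffI conjI ballI)
  assume x: "x \<in> jacobson_radical R"
  then show xR: "x \<in> carrier R"
    by (simp add: jacobson_radical_def)
  fix r assume r: "r \<in> carrier R"
  let ?y = "\<one> \<ominus> x \<otimes> r"
  have y: "?y \<in> carrier R"
    using xR r by simp
  show "\<exists>u\<in>carrier R. ?y \<otimes> u = \<one>"
  proof (rule ccontr)
    assume "\<not> ?thesis"
    then have "\<one> \<notin> ?y <# carrier R"
      by (metis mem_l_coset_carrier)
    then obtain M where M: "maximal_right_ideal M R" "?y <# carrier R \<subseteq> M"
      using maximal_right_ideal_exists right_ideal_principal[OF y] by blast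
    interpret maximal_right_ideal M R by fact
    have rM: "right_ideal M R" ..
    have "?y \<in> M"
      using M(2) y by (metis mem_l_coset_carrier one_closed r_one subsetD)
    moreover have "x \<otimes> r \<in> M"
      using x M(1) r right_ideal_mult[OF rM] by (auto simp: jacobson_radical_def)
    ultimately have "?y \<oplus> x \<otimes> r \<in> M"
      by (rule right_ideal_add[OF rM])
    moreover have "?y \<oplus> x \<otimes> r = \<one>"
      using xR r by algebra
    ultimately show False
      using right_ideal_eq_carrier[OF rM] I_notcarr by simp
  qed
next
  assume x: "x \<in> carrier R \<and> (\<forall>r\<in>carrier R. \<exists>u\<in>carrier R. (\<one> \<ominus> x \<otimes> r) \<otimes> u = \<one>)"
  have "x \<in> M" if M: "maximal_right_ideal M R" for M
  proof (rule ccontr)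
    assume nx: "x \<notin> M"
    interpret maximal_right_ideal M R by fact
    have rM: "right_ideal M R" ..
    let ?S = "{m \<oplus> x \<otimes> r | m r. m \<in> M \<and> r \<in> carrier R}"
    have S: "right_ideal ?S R"
      using right_ideal_add_principal[OF rM] x by blast
    have "m \<in> ?S" if "m \<in> M" for m
      using that x right_ideal_carrier[OF rM that] by (force intro: exI[of _ m] exI[of _ \<zero>])
    moreover have "x \<in> ?S"
      using x right_ideal_zero[OF rM] by (force intro: exI[of _ \<zero>] exI[of _ \<one>])
    ultimately have "?S = carrier R"
      using I_maximal[OF S] nx by blast
    then obtain m r where m: "\<one> = m \<oplus> x \<otimes> r" "m \<in> M" "r \<in> carrier R"
      using one_closed by blast
    have mR: "m \<in> carrier R" and xR: "x \<in> carrier R"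
      using m(2) x right_ideal_carrier[OF rM] by auto
    have "\<one> \<ominus> x \<otimes> r = m"
      unfolding m(1) using m(3) mR xR by algebra
    then obtain u where "u \<in> carrier R" "m \<otimes> u = \<one>"
      using x m(3) by metis
    then have "\<one> \<in> M"
      using right_ideal_mult[OF rM m(2)] by metis
    then show False
      using right_ideal_eq_carrier[OF rM] I_notcarr by simp
  qed
  then show "x \<in> jacobson_radical R"
    using x by (auto simp: jacobson_radical_def)
qed

section \<open>The radical as a two-sided ideal and its compression to corners\<close>

lemma jacobson_radical_carrier: "x \<in> jacobson_radical R \<Longrightarrow> x \<in> carrier R"
  by (simp add: jacobson_radical_def)

lemma right_ideal_jacobson_radical: "right_ideal (jacobson_radical R) R"
proof (rule right_idealI)
  have *: "right_ideal M R" if "maximal_right_ideal M R" for M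
    using that by (simp add: maximal_right_ideal_def)
  show "jacobson_radical R \<subseteq> carrier R" "\<zero> \<in> jacobson_radical R"
    "\<And>x y. x \<in> jacobson_radical R \<Longrightarrow> y \<in> jacobson_radical R \<Longrightarrow> x \<oplus> y \<in> jacobson_radical R"
    "\<And>x r. x \<in> jacobson_radical R \<Longrightarrow> r \<in> carrier R \<Longrightarrow> x \<otimes> r \<in> jacobson_radical R"
    using right_ideal_mem[OF *] by (auto simp: jacobson_radical_def)
qed

text \<open>If \<open>u\<close> is a right inverse of \<open>1 - ab\<close>, then \<open>1 + bua\<close> is one of \<open>1 - ba\<close>.\<close>

lemma right_inverse_one_minus_swap:
  assumes "a \<in> carrier R" "b \<in> carrier R" "u \<in> carrier R" "(\<one> \<ominus> a \<otimes> b) \<otimes> u = \<one>"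
  shows "(\<one> \<ominus> b \<otimes> a) \<otimes> (\<one> \<oplus> b \<otimes> u \<otimes> a) = \<one>"
proof -
  have "(\<one> \<ominus> b \<otimes> a) \<otimes> (\<one> \<oplus> b \<otimes> u \<otimes> a) = \<one> \<ominus> b \<otimes> a \<oplus> b \<otimes> ((\<one> \<ominus> a \<otimes> b) \<otimes> u) \<otimes> a"
    using assms(1-3) r_one[of a] by algebra
  also have "\<dots> = \<one>"
    unfolding assms(4) using assms(1-3) by algebra
  finally show ?thesis .
qed

text \<open>For x in J, 1 - x(sr) = 1 - (xs)r has a right inverse; swapping the factors xs and r
  gives one for 1 - r(xs), as the criterion for rx requires.\<close>

lemma jacobson_radical_left_mult:
  assumes "x \<in> jacobson_radical R" "r \<in> carrier R"
  shows "r \<otimes> x \<in> jacobson_radical R"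
  unfolding mem_jacobson_radical_iff
proof (intro conjI ballI)
  have x: "x \<in> carrier R"
    using assms(1) by (rule jacobson_radical_carrier)
  then show "r \<otimes> x \<in> carrier R"
    using assms(2) by simp
  fix s assume s: "s \<in> carrier R"
  obtain u where u: "u \<in> carrier R" "(\<one> \<ominus> x \<otimes> (s \<otimes> r)) \<otimes> u = \<one>"
    using assms s unfolding mem_jacobson_radical_iff by (meson m_closed)
  have "(\<one> \<ominus> r \<otimes> (x \<otimes> s)) \<otimes> (\<one> \<oplus> r \<otimes> u \<otimes> (x \<otimes> s)) = \<one>"
    using assms(2) x s u by (intro right_inverse_one_minus_swap) (simp_all add: m_assoc)
  then show "\<exists>u\<in>carrier R. (\<one> \<ominus> r \<otimes> x \<otimes> s) \<otimes> u = \<one>"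
    using assms(2) x s u(1) by (intro bexI[of _ "\<one> \<oplus> r \<otimes> u \<otimes> (x \<otimes> s)"]) (simp_all add: m_assoc)
qed

lemma jacobson_radical_right_mult:
  "x \<in> jacobson_radical R \<Longrightarrow> r \<in> carrier R \<Longrightarrow> x \<otimes> r \<in> jacobson_radical R"
  by (rule right_ideal_mult[OF right_ideal_jacobson_radical])

text \<open>The inclusion of eJe in J(eRe) is what turns semiprimitivity of the corner into eJe = 0.
  A right inverse u of 1 - w in R, with w in eRe, compresses to the right inverse eue of e - w in
  the corner.\<close>

lemma corner_jacobson_radical:
  assumes e: "ring_idempotent R e" and x: "x \<in> jacobson_radical R"
  shows "e \<otimes> x \<otimes> e \<in> jacobson_radical (corner_ring R e)"
proof -
  let ?C = "corner_ring R e"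
  interpret C: ring ?C
    using ring_axioms e by (rule ring_corner_ring)
  have eR: "e \<in> carrier R" and ee: "e \<otimes> e = e"
    using e by (auto simp: ring_idempotent_def)
  have xR: "x \<in> carrier R"
    using x by (rule jacobson_radical_carrier)
  have mem: "e \<otimes> y \<otimes> e \<in> carrier ?C" if "y \<in> carrier R" for y
    using that by (auto simp: corner_ring_def)
  have ops: "mult ?C = mult R" "add ?C = add R" "one ?C = e" "zero ?C = \<zero>"
    by (simp_all add: corner_ring_def)
  let ?y = "e \<otimes> x \<otimes> e"
  have yR: "?y \<in> carrier R"
    using xR eR by simp
  have "\<exists>u\<in>carrier ?C. (\<one>\<^bsub>?C\<^esub> \<ominus>\<^bsub>?C\<^esub> ?y \<otimes>\<^bsub>?C\<^esub> z) \<otimes>\<^bsub>?C\<^esub> u = \<one>\<^bsub>?C\<^esub>" if z: "z \<in> carrier ?C" for z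
  proof -
    obtain z' where z': "z = e \<otimes> z' \<otimes> e" "z' \<in> carrier R"
      using z by (auto simp: corner_ring_def)
    have zR: "z \<in> carrier R"
      using z' eR by simp
    have "?y \<in> jacobson_radical R"
      using x eR by (intro jacobson_radical_left_mult jacobson_radical_right_mult)
    then obtain u where u: "u \<in> carrier R" "(\<one> \<ominus> ?y \<otimes> z) \<otimes> u = \<one>"
      using zR unfolding mem_jacobson_radical_iff by blast
    let ?w = "?y \<otimes> z"
    have ew: "e \<otimes> ?w = ?w"
      using eR xR zR ee by (simp flip: m_assoc)
    have we: "?w \<otimes> e = ?w"
      using eR xR z' ee by (simp add: m_assoc)
    have wR: "?w \<in> carrier R"
      using yR zR by simp
    have wC: "?w \<in> carrier ?C"
      using mem[OF wR] ew we by simp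
    \<comment> \<open>Negation is defined through the carrier, so unlike the operations in
      \<open>ops\<close> it does not reduce by unfolding; uniqueness of additive inverses in R
      identifies the two.\<close>
    have "\<ominus>\<^bsub>?C\<^esub> ?w \<oplus> ?w = \<zero>" "\<ominus>\<^bsub>?C\<^esub> ?w \<in> carrier R"
      using C.l_neg[OF wC] C.a_inv_closed[OF wC] eR by (auto simp: ops) (auto simp: corner_ring_def)
    then have neg: "\<ominus>\<^bsub>?C\<^esub> ?w = \<ominus> ?w"
      using minus_equality wR by metis
    have "(e \<ominus> ?w) \<otimes> (e \<otimes> u \<otimes> e) = (e \<otimes> e \<ominus> ?w \<otimes> e) \<otimes> u \<otimes> e"
      using eR wR u(1) by algebra
    also have "\<dots> = (e \<ominus> e \<otimes> ?w) \<otimes> u \<otimes> e"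
      by (simp add: ee we ew)
    also have "\<dots> = e \<otimes> ((\<one> \<ominus> ?w) \<otimes> u) \<otimes> e"
      using eR wR u(1) by algebra
    also have "\<dots> = e"
      using u(2) eR ee by simp
    finally show ?thesis
      using mem[OF u(1)] by (intro bexI[of _ "e \<otimes> u \<otimes> e"]) (auto simp: ops a_minus_def neg)
  qed
  then show ?thesis
    using mem[OF xR] by (simp add: C.mem_jacobson_radical_iff)
qed

section \<open>The implications that hold in every ring\<close>

lemma right_invertible_regular:
  assumes "a \<in> carrier R" "u \<in> carrier R" "a \<otimes> u = \<one>"
  shows "regular_element R a"
  using assms by (auto simp: regular_element_def intro!: bexI[of _ u])

lemma ring_idempotent_compl:
  assumes "ring_idempotent R e"
  shows "ring_idempotent R (\<one> \<ominus> e)"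
proof -
  have e: "e \<in> carrier R" "e \<otimes> e = e"
    using assms by (auto simp: ring_idempotent_def)
  have "(\<one> \<ominus> e) \<otimes> (\<one> \<ominus> e) = \<one> \<ominus> e \<ominus> e \<oplus> e \<otimes> e"
    using e(1) r_one[of e] by algebra
  also have "\<dots> = \<one> \<ominus> e"
    unfolding e(2) using e(1) by algebra
  finally show ?thesis
    using e(1) by (simp add: ring_idempotent_def)
qed

lemma NJ_imp_VNL:
  assumes "NJ_ring R"
  shows "VNL_ring R"
  unfolding VNL_ring_def
proof
  fix a assume a: "a \<in> carrier R"
  show "regular_element R a \<or> regular_element R (\<one> \<ominus> a)"
  proof (cases "a \<in> jacobson_radical R")
    case True
    then obtain u where "u \<in> carrier R" "(\<one> \<ominus> a \<otimes> \<one>) \<otimes> u = \<one>"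
      unfolding mem_jacobson_radical_iff by blast
    then show ?thesis
      using a right_invertible_regular[of "\<one> \<ominus> a" u] by simp
  next
    case False
    then show ?thesis
      using assms a by (auto simp: NJ_ring_def)
  qed
qed

lemma regular_imp_exchange:
  assumes "regular_element R a"
  shows "\<exists>e. ring_idempotent R e \<and> e \<in> a <# carrier R \<and> \<one> \<ominus> e \<in> (\<one> \<ominus> a) <# carrier R"
proof -
  obtain b where ab: "a \<in> carrier R" "b \<in> carrier R" "a = a \<otimes> b \<otimes> a"
    using assms by (auto simp: regular_element_def)
  define f where "f = a \<otimes> b"
  have f: "f \<in> carrier R" and fa: "f \<otimes> a = a" and ff: "f \<otimes> f = f"
    using ab by (simp_all add: f_def flip: m_assoc)
  \<comment> \<open>The term a(1 - f) is added to f so that 1 - e factors as (1 - a)(1 - f), while e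
    stays in aR. Idempotence follows from ef = f and fe = e, since then ee = (ef)e = fe = e.\<close>
  define e where "e = f \<oplus> a \<otimes> (\<one> \<ominus> f)"
  have e: "e \<in> carrier R"
    using f ab by (simp add: e_def)
  have ef: "e \<otimes> f = f"
  proof -
    have "e \<otimes> f = f \<otimes> f \<oplus> a \<otimes> (f \<ominus> f \<otimes> f)"
      unfolding e_def using f ab(1) by algebra
    also have "\<dots> = f"
      unfolding ff using f ab(1) by algebra
    finally show ?thesis .
  qed
  have fe: "f \<otimes> e = e"
  proof -
    have "f \<otimes> e = f \<otimes> f \<oplus> f \<otimes> a \<otimes> (\<one> \<ominus> f)"
      unfolding e_def using f ab(1) by algebra
    then show ?thesis
      by (simp add: ff fa e_def)
  qed
  have "e \<otimes> e = e \<otimes> f \<otimes> e"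
    using e f fe by (simp add: m_assoc)
  then have "ring_idempotent R e"
    using e by (simp add: ring_idempotent_def ef fe)
  moreover have "e = a \<otimes> (b \<oplus> (\<one> \<ominus> f))"
    using ab f by (simp add: e_def r_distr flip: f_def)
  then have "e \<in> a <# carrier R"
    using ab f unfolding mem_l_coset_carrier by (auto intro!: bexI[of _ "b \<oplus> (\<one> \<ominus> f)"])
  moreover have "\<one> \<ominus> e = (\<one> \<ominus> a) \<otimes> (\<one> \<ominus> f)"
    unfolding e_def using f ab(1) by algebra
  then have "\<one> \<ominus> e \<in> (\<one> \<ominus> a) <# carrier R"
    using f unfolding mem_l_coset_carrier by (auto intro!: bexI[of _ "\<one> \<ominus> f"])
  ultimately show ?thesis
    by blast
qed

text \<open>The exchange condition is symmetric under replacing a and e by 1 - a and 1 - e, so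
  regularity of either a or 1 - a suffices.\<close>

lemma VNL_imp_exchange:
  assumes "VNL_ring R"
  shows "exchange_ring R"
  unfolding exchange_ring_def
proof
  fix a assume a: "a \<in> carrier R"
  have compl: "\<one> \<ominus> (\<one> \<ominus> x) = x" if "x \<in> carrier R" for x
    using that by algebra
  consider "regular_element R a" | "regular_element R (\<one> \<ominus> a)"
    using assms a by (auto simp: VNL_ring_def)
  then show "\<exists>e. ring_idempotent R e \<and> e \<in> a <# carrier R \<and> \<one> \<ominus> e \<in> (\<one> \<ominus> a) <# carrier R"
  proof cases
    case 1
    then show ?thesis by (rule regular_imp_exchange)
  next
    case 2
    then obtain e where e: "ring_idempotent R e" "e \<in> (\<one> \<ominus> a) <# carrier R"
      "\<one> \<ominus> e \<in> a <# carrier R"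
      using regular_imp_exchange compl[OF a] by metis
    then have "e \<in> carrier R"
      by (simp add: ring_idempotent_def)
    then show ?thesis
      using e ring_idempotent_compl compl by (intro exI[of _ "\<one> \<ominus> e"]) simp
  qed
qed

lemma exchange_imp_potent:
  assumes "exchange_ring R"
  shows "potent_ring R"
proof -
  have "\<exists>e\<in>I. ring_idempotent R e \<and> e \<noteq> \<zero>"
    if I: "right_ideal I R" "\<not> I \<subseteq> jacobson_radical R" for I
  proof -
    obtain x where x: "x \<in> I" "x \<notin> jacobson_radical R"
      using I(2) by blast
    have xR: "x \<in> carrier R"
      using right_ideal_carrier[OF I(1)] x(1) .
    \<comment> \<open>The exchange property is applied to xr, where 1 - xr has no right inverse: the
      idempotent cannot be 0, because then 1 would lie in (1 - xr)R.\<close>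
    obtain r where r: "r \<in> carrier R" "\<And>u. u \<in> carrier R \<Longrightarrow> (\<one> \<ominus> x \<otimes> r) \<otimes> u \<noteq> \<one>"
      using x(2) xR unfolding mem_jacobson_radical_iff by blast
    obtain e where e: "ring_idempotent R e" "e \<in> (x \<otimes> r) <# carrier R"
      "\<one> \<ominus> e \<in> (\<one> \<ominus> x \<otimes> r) <# carrier R"
      using assms xR r(1) unfolding exchange_ring_def by (meson m_closed)
    have "e \<in> I"
      using e(2) right_ideal_mult[OF I(1)] x(1) r(1) by (auto simp: mem_l_coset_carrier)
    moreover have "e \<noteq> \<zero>"
      using e(3) r(2) minus_zero by (metis a_minus_def mem_l_coset_carrier one_closed r_zero)
    ultimately show ?thesis
      using e(1) by blast
  qed
  then have "semipotent_ring R"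
    by (auto simp: semipotent_ring_def)
  moreover have "\<exists>e. ring_idempotent R e \<and> e \<ominus> a \<in> jacobson_radical R"
    if a: "a \<in> carrier R" "a \<otimes> a \<ominus> a \<in> jacobson_radical R" for a
  proof -
    obtain e where e: "ring_idempotent R e" "e \<in> a <# carrier R"
      "\<one> \<ominus> e \<in> (\<one> \<ominus> a) <# carrier R"
      using assms a(1) unfolding exchange_ring_def by blast
    obtain r s where rs: "r \<in> carrier R" "s \<in> carrier R" "e = a \<otimes> r" "\<one> \<ominus> e = (\<one> \<ominus> a) \<otimes> s"
      using e by (auto simp: mem_l_coset_carrier)
    have eR: "e \<in> carrier R"
      using e(1) by (simp add: ring_idempotent_def)
    \<comment> \<open>This splitting puts a factor a(1 - a) in both terms once e = ar and 1 - e = (1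
      - a)s are substituted.\<close>
    have "e \<ominus> a = (\<one> \<ominus> a) \<otimes> e \<ominus> a \<otimes> (\<one> \<ominus> e)"
      using eR a(1) r_one[of a] by algebra
    also have "\<dots> = (\<one> \<ominus> a) \<otimes> (a \<otimes> r) \<ominus> a \<otimes> ((\<one> \<ominus> a) \<otimes> s)"
      by (simp only: rs(4)) (simp only: rs(3))
    also have "\<dots> = (a \<otimes> a \<ominus> a) \<otimes> (s \<ominus> r)"
      using rs(1,2) a(1) by algebra
    also have "\<dots> \<in> jacobson_radical R"
      using a(2) rs(1,2) by (intro jacobson_radical_right_mult) auto
    finally show ?thesis
      using e(1) by blast
  qed
  ultimately show ?thesis
    by (auto simp: potent_ring_def idempotents_lift_modulo_def)
qed

end

section \<open>Semipotent rings with semiprimitive proper corners\<close>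

context ring
begin

section \<open>Calculus of complementary idempotents and Peirce components\<close>

lemma proper_idempotentD:
  assumes "proper_idempotent R e"
  shows "e \<in> carrier R" "e \<otimes> e = e" "e \<noteq> \<zero>" "e \<noteq> \<one>"
  using assms by (auto simp: proper_idempotent_def ring_idempotent_def)

lemma proper_idempotent_compl:
  assumes "proper_idempotent R e"
  shows "proper_idempotent R (\<one> \<ominus> e)"
proof -
  note e = proper_idempotentD[OF assms]
  have "\<one> \<ominus> (\<one> \<ominus> e) = e" "\<one> \<ominus> \<zero> = \<one>" "\<one> \<ominus> \<one> = \<zero>"
    using e(1) by algebra+
  then have "\<one> \<ominus> e \<noteq> \<zero>" "\<one> \<ominus> e \<noteq> \<one>"
    using e(3,4) by metis+
  then show ?thesis
    using assms ring_idempotent_compl by (simp add: proper_idempotent_def)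
qed

lemma idempotent_compl_mult:
  assumes "e \<in> carrier R" "e \<otimes> e = e"
  shows "e \<otimes> (\<one> \<ominus> e) = \<zero>" "(\<one> \<ominus> e) \<otimes> e = \<zero>"
  using assms by (simp_all add: a_minus_def l_distr r_distr l_minus r_minus r_neg)

text \<open>With p and q orthogonal idempotents this is the rule that Peirce components with
  mismatched inner indices multiply to zero.\<close>

lemma mult_zero_through:
  assumes "u \<otimes> p = u" "q \<otimes> v = v" "p \<otimes> q = \<zero>"
    "u \<in> carrier R" "p \<in> carrier R" "q \<in> carrier R" "v \<in> carrier R"
  shows "u \<otimes> v = \<zero>"
proof -
  have "u \<otimes> v = (u \<otimes> p) \<otimes> (q \<otimes> v)"
    using assms(1,2) by simp
  also have "\<dots> = u \<otimes> (p \<otimes> q) \<otimes> v"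
    using assms(4-) by (simp add: m_assoc)
  finally show ?thesis
    using assms(3-) by simp
qed

lemma peirce_decomposition:
  assumes "e \<in> carrier R" "x \<in> carrier R" "f = \<one> \<ominus> e"
  shows "x = e \<otimes> x \<otimes> e \<oplus> e \<otimes> x \<otimes> f \<oplus> f \<otimes> x \<otimes> e \<oplus> f \<otimes> x \<otimes> f"
  unfolding assms(3) using assms(1,2) r_one[of x] by algebra

end

locale semipotent_semiprimitive_corners = ring +
  assumes semipotent: "semipotent_ring R"
    and radical_nonzero: "jacobson_radical R \<noteq> {\<zero>}"
    and corner_radical: "proper_idempotent R e \<Longrightarrow>
      jacobson_radical (corner_ring R e) = {\<zero>\<^bsub>corner_ring R e\<^esub>}"
begin

section \<open>The radical in Peirce blocks, and corners as division rings\<close>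

lemma corner_radical_zero:
  assumes "proper_idempotent R e" "x \<in> jacobson_radical R"
  shows "e \<otimes> x \<otimes> e = \<zero>"
  using corner_jacobson_radical[of e x] corner_radical[of e] assms
  by (simp add: proper_idempotent_def corner_ring_def)

text \<open>Inserting p on both sides of x gives uxv = u(pxp)v. The lemma lets one proper idempotent
  p kill blocks of the radical between any two elements that p fixes on the inner sides.\<close>

lemma radical_between_zero:
  assumes p: "proper_idempotent R p" and x: "x \<in> jacobson_radical R"
    and u: "u \<in> carrier R" "u \<otimes> p = u" and v: "v \<in> carrier R" "p \<otimes> v = v"
  shows "u \<otimes> x \<otimes> v = \<zero>"
proof -
  note pR = proper_idempotentD(1)[OF p] and xR = jacobson_radical_carrier[OF x]
  have "u \<otimes> x \<otimes> v = (u \<otimes> p) \<otimes> x \<otimes> (p \<otimes> v)"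
    using u v by simp
  also have "\<dots> = u \<otimes> (p \<otimes> x \<otimes> p) \<otimes> v"
    using u(1) v(1) pR xR by (simp add: m_assoc)
  finally show ?thesis
    using corner_radical_zero[OF p x] u(1) v(1) by simp
qed

text \<open>Both diagonal blocks of every radical element vanish, so a nonzero radical must show in
  an off-diagonal one. The contradictions in \<open>corner_idempotent_trivial\<close> and
  \<open>off_diagonal_mult_zero\<close> end here.\<close>

lemma radical_off_diagonal:
  assumes e: "proper_idempotent R e" and f: "f = \<one> \<ominus> e"
  shows "\<exists>x\<in>jacobson_radical R. e \<otimes> x \<otimes> f \<noteq> \<zero> \<or> f \<otimes> x \<otimes> e \<noteq> \<zero>"
proof (rule ccontr)
  assume "\<not> ?thesis"
  then have off: "e \<otimes> x \<otimes> f = \<zero>" "f \<otimes> x \<otimes> e = \<zero>" if "x \<in> jacobson_radical R" for x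
    using that by auto
  have "x = \<zero>" if x: "x \<in> jacobson_radical R" for x
    using peirce_decomposition[OF proper_idempotentD(1)[OF e] jacobson_radical_carrier[OF x] f]
      off[OF x] corner_radical_zero[OF e x] corner_radical_zero[OF proper_idempotent_compl[OF e] x]
    by (simp flip: f)
  then show False
    using radical_nonzero right_ideal_zero[OF right_ideal_jacobson_radical] by blast
qed

text \<open>If \<open>e = g + h\<close> splits into orthogonal idempotents, then \<open>1 - h\<close> and \<open>1 - g\<close> are
  proper, so the radical vanishes between \<open>1 - e\<close> and each of \<open>g\<close>, \<open>h\<close>, hence between
  \<open>1 - e\<close> and \<open>e\<close>.\<close>

lemma corner_idempotent_trivial:
  assumes e: "proper_idempotent R e"
    and g: "g \<in> carrier R" "g \<otimes> g = g" "e \<otimes> g = g" "g \<otimes> e = g" "g \<noteq> \<zero>"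
  shows "g = e"
proof (rule ccontr)
  assume ne: "g \<noteq> e"
  note eD = proper_idempotentD[OF e]
  define f where "f = \<one> \<ominus> e"
  define h where "h = e \<ominus> g"
  have fR: "f \<in> carrier R" and hR: "h \<in> carrier R"
    using eD g by (simp_all add: f_def h_def)
  have gh: "g \<otimes> h = \<zero>" "h \<otimes> g = \<zero>"
    using eD g by (simp_all add: h_def a_minus_def l_distr r_distr l_minus r_minus r_neg)
  have eh: "e \<otimes> h = h" "h \<otimes> e = h"
    using eD g by (simp_all add: h_def a_minus_def l_distr r_distr l_minus r_minus)
  have hh: "h \<otimes> h = h"
  proof -
    have "h \<otimes> h = h \<otimes> e \<ominus> h \<otimes> g"
      unfolding h_def using eD g by algebra
    then show ?thesis
      using hR by (simp add: eh gh a_minus_def)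
  qed
  have sum: "g \<oplus> h = e"
    unfolding h_def using eD g by algebra
  have pg: "proper_idempotent R g"
    using g eD by (auto simp: proper_idempotent_def ring_idempotent_def)
  have "h \<noteq> \<zero>"
    using sum g ne by auto
  moreover have "h \<noteq> \<one>"
    using eh eD by auto
  ultimately have ph: "proper_idempotent R h"
    using hh hR by (auto simp: proper_idempotent_def ring_idempotent_def)
  have ortho: "u \<otimes> (\<one> \<ominus> v) = u" "(\<one> \<ominus> v) \<otimes> u = u"
    if "u \<in> carrier R" "v \<in> carrier R" "u \<otimes> v = \<zero>" "v \<otimes> u = \<zero>" for u v
    using that by (simp_all add: a_minus_def l_distr r_distr l_minus r_minus)
  have f_ortho: "f \<otimes> u = \<zero>" "u \<otimes> f = \<zero>" if "u \<in> carrier R" "e \<otimes> u = u" "u \<otimes> e = u" for u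
    using that eD by (simp_all add: f_def a_minus_def l_distr r_distr l_minus r_minus r_neg)
  have "e \<otimes> x \<otimes> f = \<zero> \<and> f \<otimes> x \<otimes> e = \<zero>" if x: "x \<in> jacobson_radical R" for x
  proof -
    note xR = jacobson_radical_carrier[OF x]
    \<comment> \<open>Both g and f are orthogonal to h, so 1 - h fixes them on either side; below, 1
      - g does the same for h and f.\<close>
    have "g \<otimes> x \<otimes> f = \<zero>" "f \<otimes> x \<otimes> g = \<zero>"
      using g fR hR gh eh f_ortho ortho
      by (auto intro!: radical_between_zero[OF proper_idempotent_compl[OF ph] x])
    moreover have "h \<otimes> x \<otimes> f = \<zero>" "f \<otimes> x \<otimes> h = \<zero>"
      using g fR hR gh eh f_ortho ortho
      by (auto intro!: radical_between_zero[OF proper_idempotent_compl[OF pg] x])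
    ultimately show ?thesis
      using g fR hR xR by (simp add: l_distr r_distr flip: sum)
  qed
  then show False
    using radical_off_diagonal[OF e f_def] by blast
qed

text \<open>The corner eRe is a division ring: semipotency puts a nonzero idempotent into xR, and
  triviality of the idempotents of eRe turns it into a right inverse of x, which is then
  two-sided.\<close>

lemma corner_inverse:
  assumes e: "proper_idempotent R e"
    and x: "x \<in> carrier R" "e \<otimes> x = x" "x \<otimes> e = x" "x \<noteq> \<zero>"
  shows "\<exists>y\<in>carrier R. e \<otimes> y = y \<and> y \<otimes> e = y \<and> x \<otimes> y = e \<and> y \<otimes> x = e"
proof -
  note eD = proper_idempotentD[OF e]
  have "x \<notin> jacobson_radical R"
    using corner_radical_zero[OF e] x by fastforce
  moreover have "x \<in> x <# carrier R"
    using x(1) by (auto simp: mem_l_coset_carrier intro!: bexI[of _ \<one>])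
  ultimately obtain g where g: "g \<in> x <# carrier R" "ring_idempotent R g" "g \<noteq> \<zero>"
    using semipotent right_ideal_principal[OF x(1)] unfolding semipotent_ring_def by blast
  then obtain r where r: "r \<in> carrier R" "g = x \<otimes> r"
    by (auto simp: mem_l_coset_carrier)
  have gR: "g \<in> carrier R" and gg: "g \<otimes> g = g"
    using g(2) by (auto simp: ring_idempotent_def)
  have eg: "e \<otimes> g = g"
    using eD r x by (simp flip: m_assoc)
  \<comment> \<open>The idempotent g is only known to lie in eR. The identity geg = g makes ge an
    idempotent of eRe and keeps it nonzero.\<close>
  have geg: "g \<otimes> e \<otimes> g = g"
    using eD gR by (simp add: m_assoc eg gg)
  have "g \<otimes> e = e"
  proof (rule corner_idempotent_trivial[OF e])
    show "g \<otimes> e \<in> carrier R"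
      using gR eD by simp
    show "g \<otimes> e \<otimes> (g \<otimes> e) = g \<otimes> e"
      using gR eD geg by (simp flip: m_assoc)
    show "e \<otimes> (g \<otimes> e) = g \<otimes> e"
      using gR eD eg by (simp flip: m_assoc)
    show "g \<otimes> e \<otimes> e = g \<otimes> e"
      using gR eD by (simp add: m_assoc)
    show "g \<otimes> e \<noteq> \<zero>"
      using geg gR g(3) by auto
  qed
  define y where "y = e \<otimes> r \<otimes> e"
  have y: "y \<in> carrier R" "e \<otimes> y = y" "y \<otimes> e = y"
    using eD r by (simp_all add: y_def m_assoc) (simp flip: m_assoc)
  have "x \<otimes> y = x \<otimes> e \<otimes> r \<otimes> e"
    unfolding y_def using x(1) eD(1) r(1) by (simp add: m_assoc)
  then have xy: "x \<otimes> y = e"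
    using x r \<open>g \<otimes> e = e\<close> by simp
  \<comment> \<open>From xy = e, the product yx is idempotent; it is nonzero because x(yx) = x, so
    it equals e.\<close>
  have "y \<otimes> x = e"
  proof (rule corner_idempotent_trivial[OF e])
    show "y \<otimes> x \<in> carrier R"
      using x y by simp
    have "y \<otimes> x \<otimes> (y \<otimes> x) = y \<otimes> (x \<otimes> y) \<otimes> x"
      using x y by (simp add: m_assoc)
    then show "y \<otimes> x \<otimes> (y \<otimes> x) = y \<otimes> x"
      using xy y by simp
    show "e \<otimes> (y \<otimes> x) = y \<otimes> x"
      using x y eD by (simp flip: m_assoc)
    show "y \<otimes> x \<otimes> e = y \<otimes> x"
      using x y eD by (simp add: m_assoc)
    have "x \<otimes> (y \<otimes> x) = x"
      using x y xy by (simp flip: m_assoc)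
    then show "y \<otimes> x \<noteq> \<zero>"
      using x by auto
  qed
  then show ?thesis
    using y xy by blast
qed

text \<open>A nonzero product would make the idempotents \<open>e\<close> and \<open>1 - e\<close> equivalent, and the
  radical, which vanishes on both diagonal blocks, would then vanish on the other two.\<close>

lemma off_diagonal_mult_zero:
  assumes e: "proper_idempotent R e" and f: "f = \<one> \<ominus> e"
    and m: "m \<in> carrier R" "e \<otimes> m = m" "m \<otimes> f = m"
    and n: "n \<in> carrier R" "f \<otimes> n = n" "n \<otimes> e = n"
  shows "m \<otimes> n = \<zero>"
proof (rule ccontr)
  assume nz: "m \<otimes> n \<noteq> \<zero>"
  note eD = proper_idempotentD[OF e]
  have pf: "proper_idempotent R f"
    using proper_idempotent_compl[OF e] f by simp
  note fD = proper_idempotentD[OF pf]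
  have "e \<otimes> (m \<otimes> n) = m \<otimes> n" "m \<otimes> n \<otimes> e = m \<otimes> n"
    using eD m n by (simp flip: m_assoc, simp add: m_assoc)
  then obtain k where k: "k \<in> carrier R" "k \<otimes> e = k" "m \<otimes> n \<otimes> k = e"
    using corner_inverse[OF e _ _ _ nz] m n by auto
  \<comment> \<open>As k is a right inverse of mn in eRe, l is a right inverse of m from the block
    fRe; together m and l realise the equivalence of e and f.\<close>
  define l where "l = n \<otimes> k"
  have l: "l \<in> carrier R" "f \<otimes> l = l" "l \<otimes> e = l"
    using n k eD fD by (simp_all add: l_def m_assoc) (simp flip: m_assoc)
  have ml: "m \<otimes> l = e"
    using k m n by (simp add: l_def m_assoc)
  have lm: "l \<otimes> m = f"
  proof (rule corner_idempotent_trivial[OF pf])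
    show "l \<otimes> m \<in> carrier R"
      using l m by simp
    have "l \<otimes> m \<otimes> (l \<otimes> m) = l \<otimes> (m \<otimes> l) \<otimes> m"
      using l m by (simp add: m_assoc)
    then show "l \<otimes> m \<otimes> (l \<otimes> m) = l \<otimes> m"
      using ml l by simp
    show "f \<otimes> (l \<otimes> m) = l \<otimes> m"
      using l m fD by (simp flip: m_assoc)
    show "l \<otimes> m \<otimes> f = l \<otimes> m"
      using l m fD by (simp add: m_assoc)
    have "m \<otimes> (l \<otimes> m) = m"
      using l m ml by (simp flip: m_assoc)
    then show "l \<otimes> m \<noteq> \<zero>"
      using m ml eD(3) l by auto
  qed
  have "e \<otimes> x \<otimes> f = \<zero> \<and> f \<otimes> x \<otimes> e = \<zero>" if x: "x \<in> jacobson_radical R" for x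
  proof -
    note xR = jacobson_radical_carrier[OF x]
    \<comment> \<open>Replacing f by lm moves the off-diagonal block to the diagonal one of xl,
      which is again in J; e = ml handles the other block.\<close>
    have "e \<otimes> x \<otimes> f = e \<otimes> (x \<otimes> l) \<otimes> e \<otimes> m"
      unfolding lm[symmetric] using eD l m xR by (simp add: m_assoc)
    moreover have "f \<otimes> x \<otimes> e = f \<otimes> (x \<otimes> m) \<otimes> f \<otimes> l"
      unfolding ml[symmetric] using fD l m xR by (simp add: m_assoc)
    ultimately show ?thesis
      using corner_radical_zero[OF e jacobson_radical_right_mult[OF x l(1)]]
        corner_radical_zero[OF pf jacobson_radical_right_mult[OF x m(1)]] l m by simp
  qed
  then show False
    using radical_off_diagonal[OF e f] by blast
qed

section \<open>Regularity of the elements outside the radical\<close>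

lemma NJ: "NJ_ring R"
  unfolding NJ_ring_def
proof
  fix a assume "a \<in> carrier R - jacobson_radical R"
  then have aR: "a \<in> carrier R" and aJ: "a \<notin> jacobson_radical R"
    by auto
  have "a \<in> a <# carrier R"
    using aR by (auto simp: mem_l_coset_carrier intro!: bexI[of _ \<one>])
  then obtain e where e: "e \<in> a <# carrier R" "ring_idempotent R e" "e \<noteq> \<zero>"
    using semipotent right_ideal_principal[OF aR] aJ unfolding semipotent_ring_def by blast
  then obtain r where r: "r \<in> carrier R" "e = a \<otimes> r"
    by (auto simp: mem_l_coset_carrier)
  show "regular_element R a"
  proof (cases "e = \<one>")
    case True
    then show ?thesis
      using right_invertible_regular aR r by auto
  next
    case False
    then have pe: "proper_idempotent R e"
      using e by (simp add: proper_idempotent_def)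
    define f where "f = \<one> \<ominus> e"
    have pf: "proper_idempotent R f"
      using proper_idempotent_compl[OF pe] f_def by simp
    note eD = proper_idempotentD[OF pe] and fD = proper_idempotentD[OF pf]
    have ef: "e \<otimes> f = \<zero>" "f \<otimes> e = \<zero>"
      using idempotent_compl_mult eD by (simp_all add: f_def)
    \<comment> \<open>This form allows \<open>off_diagonal_mult_zero\<close> to be used with e and f
      exchanged.\<close>
    have e_def: "e = \<one> \<ominus> f"
      unfolding f_def using eD(1) by algebra
    have sum: "e \<oplus> f = \<one>"
      unfolding f_def using eD(1) by algebra
    have block: "p \<otimes> x \<otimes> q \<in> carrier R \<and> p \<otimes> (p \<otimes> x \<otimes> q) = p \<otimes> x \<otimes> q \<and>
        p \<otimes> x \<otimes> q \<otimes> q = p \<otimes> x \<otimes> q"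
      if "proper_idempotent R p" "proper_idempotent R q" "x \<in> carrier R" for p q x
      using proper_idempotentD[OF that(1)] proper_idempotentD[OF that(2)] that(3)
      by (simp add: m_assoc) (simp flip: m_assoc)
    \<comment> \<open>In Peirce form a is the 2 by 2 matrix with rows (d, m) and (n, c).\<close>
    define d where "d = e \<otimes> a \<otimes> e"
    define m where "m = e \<otimes> a \<otimes> f"
    define n where "n = f \<otimes> a \<otimes> e"
    define c where "c = f \<otimes> a \<otimes> f"
    have a_eq: "a = d \<oplus> m \<oplus> n \<oplus> c"
      unfolding d_def m_def n_def c_def using peirce_decomposition[OF eD(1) aR f_def] .
    have d: "d \<in> carrier R" "e \<otimes> d = d" "d \<otimes> e = d"
      and m: "m \<in> carrier R" "e \<otimes> m = m" "m \<otimes> f = m"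
      and n: "n \<in> carrier R" "f \<otimes> n = n" "n \<otimes> e = n"
      and c: "c \<in> carrier R" "f \<otimes> c = c" "c \<otimes> f = c"
      using block pe pf aR by (simp_all add: d_def m_def n_def c_def)
    have "d \<noteq> \<zero>"
    proof
      assume "d = \<zero>"
      \<comment> \<open>Inserting 1 = ee + ff between a and r writes e = e(ar)e as eae times ere
        plus eaf times fre; the first product vanishes with d, the second is a product of opposite
        off-diagonal elements.\<close>
      have "e = e \<otimes> (a \<otimes> (e \<oplus> f) \<otimes> r) \<otimes> e"
        using r eD aR sum by simp
      also have "\<dots> = e \<otimes> a \<otimes> (e \<otimes> e \<oplus> f \<otimes> f) \<otimes> r \<otimes> e"
        using aR r(1) eD(1,2) fD(1,2) by (simp add: m_assoc)
      also have "\<dots> = d \<otimes> (e \<otimes> r \<otimes> e) \<oplus> m \<otimes> (f \<otimes> r \<otimes> e)"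
        unfolding d_def m_def using aR r(1) eD(1) fD(1) by algebra
      also have "\<dots> = \<zero>"
        using off_diagonal_mult_zero[OF pe f_def m] block[OF pf pe r(1)] \<open>d = \<zero>\<close> eD r by simp
      finally show False
        using eD by simp
    qed
    then obtain d' where d': "d' \<in> carrier R" "e \<otimes> d' = d'" "d' \<otimes> e = d'" "d \<otimes> d' = e"
      "d' \<otimes> d = e"
      using corner_inverse[OF pe d] by blast
    have md': "m \<otimes> d' = \<zero>" and d'n: "d' \<otimes> n = \<zero>"
      using mult_zero_through[OF m(3) d'(2) ef(2)] mult_zero_through[OF d'(3) n(2) ef(1)]
        m d' n eD fD by auto
    have nd': "n \<otimes> d' \<in> carrier R" "f \<otimes> (n \<otimes> d') = n \<otimes> d'" "n \<otimes> d' \<otimes> e = n \<otimes> d'"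
      using n d' eD fD by (simp_all add: m_assoc) (simp flip: m_assoc)
    have nd'm: "n \<otimes> d' \<otimes> m = \<zero>"
      using off_diagonal_mult_zero[OF pf e_def nd' m] .
    show ?thesis
    proof (cases "c = \<zero>")
      case True
      then have a_eq': "a = d \<oplus> m \<oplus> n"
        using a_eq d m n by simp
      \<comment> \<open>Multiplying e + nd' by a on the right, e contributes d + m and nd'
        contributes nd'd = n, all other products being zero.\<close>
      have "a \<otimes> d' = e \<oplus> n \<otimes> d'"
        using d m n d' md' eD by (simp add: a_eq' l_distr)
      moreover have "n \<otimes> d' \<otimes> n = \<zero>" "n \<otimes> d' \<otimes> d = n" "e \<otimes> n = \<zero>"
        using n d d' d'n mult_zero_through[OF eD(2) n(2) ef(1)] eD fD by (simp_all add: m_assoc)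
      ultimately have "a \<otimes> d' \<otimes> a = d \<oplus> m \<oplus> n"
        using d m n d' nd'm eD by (simp add: a_eq' l_distr r_distr a_ac)
      then show ?thesis
        using a_eq' aR d'(1) unfolding regular_element_def by metis
    next
      case False
      then obtain c' where c': "c' \<in> carrier R" "f \<otimes> c' = c'" "c' \<otimes> f = c'" "c \<otimes> c' = f"
        using corner_inverse[OF pf c] by blast
      have mc': "m \<otimes> c' \<in> carrier R" "e \<otimes> (m \<otimes> c') = m \<otimes> c'" "m \<otimes> c' \<otimes> f = m \<otimes> c'"
        using m c' eD fD by (simp_all add: m_assoc) (simp flip: m_assoc)
      \<comment> \<open>The element d' + c' inverts the diagonal of a, and a(d' + c') = 1 + j with j
        the off-diagonal remainder. Since j squares to zero, 1 - j corrects this to a right inverse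
        of a.\<close>
      define j where "j = m \<otimes> c' \<oplus> n \<otimes> d'"
      have jR: "j \<in> carrier R"
        using mc' nd' by (simp add: j_def)
      have "m \<otimes> c' \<otimes> (m \<otimes> c') = \<zero>" "n \<otimes> d' \<otimes> (n \<otimes> d') = \<zero>"
        using mult_zero_through[OF mc'(3) mc'(2) ef(2)] mult_zero_through[OF nd'(3) nd'(2) ef(1)]
          mc' nd' eD fD by auto
      moreover have "m \<otimes> c' \<otimes> (n \<otimes> d') = \<zero>" "n \<otimes> d' \<otimes> (m \<otimes> c') = \<zero>"
        using off_diagonal_mult_zero[OF pe f_def mc' nd'] off_diagonal_mult_zero[OF pf e_def nd' mc']
        by auto
      ultimately have jj: "j \<otimes> j = \<zero>"
        unfolding j_def using mc'(1) nd'(1) by (simp only: l_distr r_distr a_closed) simp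
      have "d \<otimes> c' = \<zero>" "n \<otimes> c' = \<zero>" "c \<otimes> d' = \<zero>"
        using mult_zero_through[OF d(3) c'(2) ef(1)] mult_zero_through[OF n(3) c'(2) ef(1)]
          mult_zero_through[OF c(3) d'(2) ef(2)] c c' d d' n eD fD by auto
      then have "a \<otimes> (d' \<oplus> c') = (e \<oplus> f) \<oplus> j"
        using d m n c d' c' md' eD fD mc' nd' by (simp add: a_eq j_def l_distr r_distr a_ac)
      then have "a \<otimes> ((d' \<oplus> c') \<otimes> (\<one> \<ominus> j)) = (\<one> \<oplus> j) \<otimes> (\<one> \<ominus> j)"
        using aR d' c' jR sum by (simp flip: m_assoc)
      also have "\<dots> = \<one> \<ominus> j \<otimes> j"
        using jR r_one[of j] by algebra
      also have "\<dots> = \<one>"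
        by (simp add: jj a_minus_def)
      finally show ?thesis
        using right_invertible_regular[OF aR] d'(1) c'(1) jR
        by (meson a_closed m_closed minus_closed one_closed)
    qed
  qed
qed

end

theorem proposition5p2:
  fixes R :: "('a, 'b) ring_scheme"
  assumes "ring R"
    and "\<not> (\<exists>e. proper_idempotent R e \<and> central_element R e)"
    and "jacobson_radical R \<noteq> {\<zero>\<^bsub>R\<^esub>}"
    and "\<And>e. proper_idempotent R e \<Longrightarrow>
           jacobson_radical (corner_ring R e) = {\<zero>\<^bsub>corner_ring R e\<^esub>}"
  shows "(VNL_ring R \<longleftrightarrow> exchange_ring R) \<and>
         (exchange_ring R \<longleftrightarrow> potent_ring R) \<and>
         (potent_ring R \<longleftrightarrow> semipotent_ring R) \<and>
         (semipotent_ring R \<longleftrightarrow> NJ_ring R)"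
proof -
  interpret ring R by fact
  have "NJ_ring R" if "semipotent_ring R"
    using that assms by (intro semipotent_semiprimitive_corners.NJ)
      (simp add: semipotent_semiprimitive_corners_def semipotent_semiprimitive_corners_axioms_def)
  then show ?thesis
    using NJ_imp_VNL VNL_imp_exchange exchange_imp_potent by (auto simp: potent_ring_def)
qed

end
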